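(* Let $d\ge1$, $n\ge0$ be integers, let $A$ be the adjacency matrix of $\mathrm{SR}(d,n)$, and let $\pi\in\mathfrak{S}_{d,n}$. Then $\mathbf{F}_\pi$ is an eigenvector of $A$ with eigenvalue $-n$. Moreover, if $n<\binom{d}{2}$, then the set $\{\mathbf{F}_\pi:\pi\in\mathfrak{S}_{d,n}\}$ is linearly independent; in particular, the dimension of the $(-n)$-eigenspace of $A$ is at least the Mahonian number $M(d,n)=|\mathfrak{S}_{d,n}|$.
   Context: $\mathrm{SR}(d,n)$ has vertex set $V(d,n)=\{x\in\mathbb{Z}_{\ge0}^d:\sum_i x_i=n\}$, two vertices adjacent if they differ in exactly two coordinates; $A$ acts on $\mathbb{R}^N$, $N=|V(d,n)|$, with standard basis $\{\mathbf{e}_x:x\in V(d,n)\}$, via $A\mathbf{e}_x=\sum_{y\sim x}\mathbf{e}_y$. Permutations $\sigma\in\mathfrak{S}_d$ are written in one-line notation $\sigma=(\sigma_1,\dots,\sigma_d)$, and $\varepsilon(\sigma)$ is the sign. An inversion of $\pi$ is a pair $i<j$ with $\pi_i>\pi_j$; $\mathfrak{S}_{d,n}$ is the set of permutations of $[d]$ with exactly $n$ inversions. For $\pi\in\mathfrak{S}_{d,n}$, its inversion word is $a=a(\pi)=(a_1,\dots,a_d)$ with $a_i=\#\{j: i<j,\ \pi_i>\pi_j\}$ (a vertex of $\mathrm{SR}(d,n)$). For $\sigma\in\mathfrak{S}_d$ put $x(\sigma)=(a_1+1-\sigma_1,\ a_2+2-\sigma_2,\dots,a_d+d-\sigma_d)$;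 its coordinates sum to $n$. The set of $\pi$-admissible permutations is $\mathrm{Adm}(\pi)=\{\sigma\in\mathfrak{S}_d: a_i+i-\sigma_i\ge0\ \text{for all } i\}$ (so $x(\sigma)\in V(d,n)$ exactly for these). The partial permutohedron vector is $\mathbf{F}_\pi=\sum_{\sigma\in\mathrm{Adm}(\pi)}\varepsilon(\sigma)\,\mathbf{e}_{x(\sigma)}$. *)

theory Defs
  imports "HOL-Analysis.Analysis" "HOL-Analysis.Finite_Function_Topology" "HOL-Combinatorics.Permutations"
begin

(* A point of Z^d is a function on nat vanishing outside {1..d}. *)
definition SR_verts :: "nat \<Rightarrow> nat \<Rightarrow> (nat \<Rightarrow> int) set" where
  "SR_verts d n = {x. (\<forall>i. i \<notin> {1..d} \<longrightarrow> x i = 0) \<and> (\<forall>i\<in>{1..d}. 0 \<le> x i) \<and>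
                      (\<Sum>i=1..d. x i) = int n}"

definition SR_adj :: "nat \<Rightarrow> nat \<Rightarrow> (nat \<Rightarrow> int) \<Rightarrow> (nat \<Rightarrow> int) \<Rightarrow> bool" where
  "SR_adj d n x y \<longleftrightarrow>
     x \<in> SR_verts d n \<and> y \<in> SR_verts d n \<and> card {i\<in>{1..d}. x i \<noteq> y i} = 2"

definition SR_adjacency_matrix :: "nat \<Rightarrow> nat \<Rightarrow> (nat \<Rightarrow> int) \<Rightarrow> (nat \<Rightarrow> int) \<Rightarrow> real" where
  "SR_adjacency_matrix d n x y = (if SR_adj d n x y then 1 else 0)"

(* R^N, N = card (SR_verts d n), as the real vectors with coordinates indexed by the vertices:
   the finitely supported functions whose support lies in the vertex set. *)
definition SR_space :: "nat \<Rightarrow> nat \<Rightarrow> ((nat \<Rightarrow> int) \<Rightarrow>\<^sub>0 real) set" where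
  "SR_space d n = {v. Poly_Mapping.keys v \<subseteq> SR_verts d n}"

definition basis_vec :: "(nat \<Rightarrow> int) \<Rightarrow> ((nat \<Rightarrow> int) \<Rightarrow>\<^sub>0 real)" where
  "basis_vec x = Poly_Mapping.single x 1"

(* The matrix-vector product of the adjacency matrix with v. *)
definition SR_A :: "nat \<Rightarrow> nat \<Rightarrow> ((nat \<Rightarrow> int) \<Rightarrow>\<^sub>0 real) \<Rightarrow> ((nat \<Rightarrow> int) \<Rightarrow>\<^sub>0 real)" where
  "SR_A d n v =
     (\<Sum>y\<in>SR_verts d n.
        (\<Sum>x\<in>SR_verts d n. SR_adjacency_matrix d n y x * Poly_Mapping.lookup v x) *\<^sub>R basis_vec y)"

definition SR_eigenvector :: "nat \<Rightarrow> nat \<Rightarrow> real \<Rightarrow> ((nat \<Rightarrow> int) \<Rightarrow>\<^sub>0 real) \<Rightarrow> bool" where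
  "SR_eigenvector d n k v \<longleftrightarrow> v \<in> SR_space d n \<and> v \<noteq> 0 \<and> SR_A d n v = k *\<^sub>R v"

definition SR_eigenspace :: "nat \<Rightarrow> nat \<Rightarrow> real \<Rightarrow> ((nat \<Rightarrow> int) \<Rightarrow>\<^sub>0 real) set" where
  "SR_eigenspace d n k = {v \<in> SR_space d n. SR_A d n v = k *\<^sub>R v}"

definition inversions :: "nat \<Rightarrow> (nat \<Rightarrow> nat) \<Rightarrow> (nat \<times> nat) set" where
  "inversions d \<pi> = {(i, j). i \<in> {1..d} \<and> j \<in> {1..d} \<and> i < j \<and> \<pi> i > \<pi> j}"

definition perms_inv :: "nat \<Rightarrow> nat \<Rightarrow> (nat \<Rightarrow> nat) set" where
  "perms_inv d n = {\<pi>. \<pi> permutes {1..d} \<and> card (inversions d \<pi>) = n}"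

definition mahonian :: "nat \<Rightarrow> nat \<Rightarrow> nat" where
  "mahonian d n = card (perms_inv d n)"

definition inversion_word :: "nat \<Rightarrow> (nat \<Rightarrow> nat) \<Rightarrow> nat \<Rightarrow> nat" where
  "inversion_word d \<pi> i = card {j\<in>{1..d}. i < j \<and> \<pi> i > \<pi> j}"

(* If both arguments permute {1..d}, this vanishes for i outside {1..d}. *)
definition perm_point :: "nat \<Rightarrow> (nat \<Rightarrow> nat) \<Rightarrow> (nat \<Rightarrow> nat) \<Rightarrow> (nat \<Rightarrow> int)" where
  "perm_point d \<pi> \<sigma> = (\<lambda>i. int (inversion_word d \<pi> i) + int i - int (\<sigma> i))"

definition admissible :: "nat \<Rightarrow> (nat \<Rightarrow> nat) \<Rightarrow> (nat \<Rightarrow> nat) set" where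
  "admissible d \<pi> =
     {\<sigma>. \<sigma> permutes {1..d} \<and> (\<forall>i\<in>{1..d}. int (inversion_word d \<pi> i) + int i - int (\<sigma> i) \<ge> 0)}"

definition partial_permutohedron_vec ::
    "nat \<Rightarrow> (nat \<Rightarrow> nat) \<Rightarrow> ((nat \<Rightarrow> int) \<Rightarrow>\<^sub>0 real)" where
  "partial_permutohedron_vec d \<pi> =
     (\<Sum>\<sigma>\<in>admissible d \<pi>. of_int (sign \<sigma>) *\<^sub>R basis_vec (perm_point d \<pi> \<sigma>))"

lemma finite_SR_verts: "finite (SR_verts d n)"
proof -
  have "SR_verts d n \<subseteq> {f. \<forall>i. (i \<in> {1..d} \<longrightarrow> f i \<in> {0..int n}) \<and> (i \<notin> {1..d} \<longrightarrow> f i = 0)}"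
  proof
    fix x assume x: "x \<in> SR_verts d n"
    have "x i \<le> int n" if "i \<in> {1..d}" for i
    proof -
      have "x i \<le> (\<Sum>i=1..d. x i)"
        by (rule member_le_sum) (use that x in \<open>auto simp: SR_verts_def\<close>)
      then show ?thesis using x by (simp add: SR_verts_def)
    qed
    then show "x \<in> {f. \<forall>i. (i \<in> {1..d} \<longrightarrow> f i \<in> {0..int n}) \<and> (i \<notin> {1..d} \<longrightarrow> f i = 0)}"
      using x by (auto simp: SR_verts_def)
  qed
  then show ?thesis
    by (rule finite_subset) (rule finite_set_of_finite_funs; simp)
qed

lemma SR_A_basis_vec:
  assumes "x \<in> SR_verts d n"
  shows "SR_A d n (basis_vec x) = (\<Sum>y | SR_adj d n x y. basis_vec y)"
proof -
  have sym: "SR_adj d n x y \<longleftrightarrow> SR_adj d n y x" for y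
    by (simp add: SR_adj_def eq_commute[of "x _"] conj_ac)
  have "SR_A d n (basis_vec x) =
      (\<Sum>y\<in>SR_verts d n. if SR_adj d n x y then basis_vec y else 0)"
    unfolding SR_A_def
  proof (rule sum.cong[OF refl])
    fix y assume "y \<in> SR_verts d n"
    have "(\<Sum>z\<in>SR_verts d n. SR_adjacency_matrix d n y z * Poly_Mapping.lookup (basis_vec x) z) =
        (\<Sum>z\<in>SR_verts d n. if x = z then SR_adjacency_matrix d n y z else 0)"
      by (rule sum.cong) (auto simp: basis_vec_def lookup_single when_def)
    also have "\<dots> = SR_adjacency_matrix d n y x"
      using assms finite_SR_verts by simp
    finally show "(\<Sum>z\<in>SR_verts d n. SR_adjacency_matrix d n y z *
          Poly_Mapping.lookup (basis_vec x) z) *\<^sub>R basis_vec y =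
        (if SR_adj d n x y then basis_vec y else 0)"
      by (simp add: SR_adjacency_matrix_def sym)
  qed
  also have "\<dots> = (\<Sum>y | SR_adj d n x y. basis_vec y)"
    by (rule sum.mono_neutral_cong_right) (auto simp: finite_SR_verts SR_adj_def)
  finally show ?thesis .
qed

end

theory Submission
  imports Defs
begin

text \<open>
  Write \<open>w i = a i + i\<close>, so that \<open>w i \<le> d\<close>, and identify a vertex \<open>y\<close> with \<open>p = w - y\<close>. The
  coefficient of \<open>A F\<close> at \<open>y\<close> is the signed sum over the permutations \<open>\<tau> \<le> w\<close> that differ from
  \<open>p\<close> in exactly two positions. As \<open>\<tau>\<close> and \<open>p\<close> have the same sum, one of these positions, \<open>r\<close>,
  satisfies \<open>\<tau> r < p r \<le> d\<close>; let \<open>\<tau> k = p r\<close>. If \<open>p\<close> is not a permutation, then \<open>p k = \<tau> k\<close>,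
  and swapping the values of \<open>\<tau>\<close> at \<open>r\<close> and \<open>k\<close> is a sign-reversing involution, so the sum
  vanishes. If \<open>p\<close> is a permutation \<open>\<rho>\<close>, then the \<open>\<tau>\<close> arise by swapping two positions
  \<open>i, k\<close> with \<open>\<rho> i < \<rho> k \<le> w i\<close>, and there are \<open>\<Sum>i. w i - \<rho> i = n\<close> such pairs.
  Linear independence holds because the supports are triangular with respect to the functional
  \<open>x \<mapsto> \<Sum>i. i * x i\<close>.
\<close>

section \<open>Permutations differing from a given point in two coordinates\<close>

text \<open>For \<open>w i = inversion_word d \<pi> i + i\<close> this is
  \<open>admissible d \<pi>\<close>. The signed counts below use of the inversion word only that
  \<open>w i \<le> d\<close>, hence the general bound \<open>w\<close>.\<close>

definition perms_below :: "nat \<Rightarrow> (nat \<Rightarrow> int) \<Rightarrow> (nat \<Rightarrow> nat) set" where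
  "perms_below d w = {\<sigma>. \<sigma> permutes {1..d} \<and> (\<forall>i\<in>{1..d}. int (\<sigma> i) \<le> w i)}"

text \<open>With \<open>p = w - y\<close> these are the permutations whose points are the neighbours
  of the vertex \<open>y\<close>. The values of \<open>p\<close> may repeat or be negative, so
  \<open>p\<close> is an integer-valued function.\<close>

definition near_perms :: "nat \<Rightarrow> (nat \<Rightarrow> int) \<Rightarrow> (nat \<Rightarrow> int) \<Rightarrow> (nat \<Rightarrow> nat) set" where
  "near_perms d w p = {\<sigma>\<in>perms_below d w. card {i\<in>{1..d}. int (\<sigma> i) \<noteq> p i} = 2}"

lemma finite_perms_below [simp]: "finite (perms_below d w)"
  unfolding perms_below_def
  by (rule finite_subset[OF _ finite_permutations[of "{1..d}"]]) auto

lemma finite_near_perms [simp]: "finite (near_perms d w p)"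
  unfolding near_perms_def by simp

lemma sign_compose_transpose:
  assumes "\<sigma> permutes {1..d::nat}" "i \<noteq> j"
  shows "sign (\<sigma> \<circ> Transposition.transpose i j) = - sign \<sigma>"
proof -
  have "permutation \<sigma>"
    using assms(1) by (rule permutes_imp_permutation[rotated]) simp
  moreover have "permutation (Transposition.transpose i j)"
    by (rule permutation_swap_id)
  ultimately show ?thesis
    using assms(2) by (simp add: sign_compose sign_swap_id)
qed

text \<open>Since \<tau> and \<open>p\<close> have equal sums, the two deviations cancel: one is a
  deficit, at \<open>r\<close>, the other an excess, at \<open>s\<close>.\<close>

lemma near_permE:
  assumes "\<tau> \<in> near_perms d w p"
    and "(\<Sum>i=1..d. p i) = (\<Sum>i=1..d. int i)"
  obtains r s where "\<forall>i\<in>{1..d}. i \<noteq> r \<longrightarrow> i \<noteq> s \<longrightarrow> int (\<tau> i) = p i" "r \<in> {1..d}" "s \<in> {1..d}"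
    "int (\<tau> r) < p r" "p s < int (\<tau> s)" "int (\<tau> r) + int (\<tau> s) = p r + p s"
proof -
  let ?D = "{i\<in>{1..d}. int (\<tau> i) \<noteq> p i}"
  have perm: "\<tau> permutes {1..d}" and card: "card ?D = 2"
    using assms(1) by (auto simp: near_perms_def perms_below_def)
  obtain r s where rs: "?D = {r, s}" "r \<noteq> s"
    using card by (auto simp: card_2_iff)
  have "(\<Sum>i=1..d. int (\<tau> i)) = (\<Sum>i=1..d. int i)"
    by (rule sum.permute[OF perm, of int, symmetric, unfolded o_def])
  then have "(\<Sum>i=1..d. int (\<tau> i) - p i) = 0"
    using assms(2) by (simp add: sum_subtractf)
  moreover have "(\<Sum>i=1..d. int (\<tau> i) - p i) = (\<Sum>i\<in>?D. int (\<tau> i) - p i)"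
    by (rule sum.mono_neutral_right) auto
  ultimately have eq: "int (\<tau> r) + int (\<tau> s) = p r + p s"
    using rs by simp
  have "r \<in> ?D" "s \<in> ?D"
    unfolding rs(1) by auto
  then have mem: "r \<in> {1..d}" "s \<in> {1..d}" "int (\<tau> r) \<noteq> p r"
    by auto
  have "int (\<tau> i) = p i" if "i \<in> {1..d}" "i \<noteq> r" "i \<noteq> s" for i
  proof -
    have "i \<notin> ?D"
      unfolding rs(1) using that by simp
    then show ?thesis
      using that by simp
  qed
  then have off: "\<forall>i\<in>{1..d}. i \<noteq> r \<longrightarrow> i \<noteq> s \<longrightarrow> int (\<tau> i) = p i"
    and off': "\<forall>i\<in>{1..d}. i \<noteq> s \<longrightarrow> i \<noteq> r \<longrightarrow> int (\<tau> i) = p i"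
    by blast+
  consider "int (\<tau> r) < p r" "p s < int (\<tau> s)" | "int (\<tau> s) < p s" "p r < int (\<tau> r)"
    using mem(3) eq by linarith
  then show ?thesis
  proof cases
    case 1
    show ?thesis
      by (rule that[OF off mem(1,2) 1 eq])
  next
    case 2
    show ?thesis
      by (rule that[OF off' mem(2,1) 2]) (use eq in simp)
  qed
qed

text \<open>Swapping \<tau> at the deficit position and at the position holding the missing value
  moves the deficit to the latter, where the same rule selects the reverse swap.\<close>

lemma sum_sign_near_perms_nonperm:
  assumes wd: "\<And>i. i \<in> {1..d} \<Longrightarrow> w i \<le> int d"
    and pw: "\<And>i. i \<in> {1..d} \<Longrightarrow> p i \<le> w i"
    and psum: "(\<Sum>i=1..d. p i) = (\<Sum>i=1..d. int i)"
    and nonperm: "\<not> (\<exists>\<rho>. \<rho> permutes {1..d} \<and> (\<forall>i\<in>{1..d}. int (\<rho> i) = p i))"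
  shows "(\<Sum>\<tau>\<in>near_perms d w p. sign \<tau>) = 0"
proof -
  let ?N = "near_perms d w p"
  let ?D = "\<lambda>\<tau>. {i\<in>{1..d}. int (\<tau> i) \<noteq> p i}"
  \<comment> \<open>The deficit is at \<open>r\<close>, the excess at \<open>s\<close>, and
    \<open>k\<close> is a third position, at which \<open>p\<close> repeats the value
    \<open>p r\<close>.\<close>
  define P where "P \<tau> r k s \<longleftrightarrow> r \<in> {1..d} \<and> k \<in> {1..d} \<and> s \<in> {1..d} \<and> r \<noteq> s \<and> k \<noteq> r \<and> k \<noteq> s \<and>
      (\<forall>i\<in>{1..d}. i \<noteq> r \<longrightarrow> i \<noteq> s \<longrightarrow> int (\<tau> i) = p i) \<and> int (\<tau> r) < p r \<and> p s < int (\<tau> s) \<and> int (\<tau> k) = p r \<and> p k = p r" for \<tau> r k s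
  \<comment> \<open>For \<tau> in \<open>?N\<close> the deficit position is unique and \<tau> is
    injective, so \<open>r\<close> and \<open>k\<close> can be recovered from \<tau> alone.\<close>
  define row where "row \<tau> = (THE r. r \<in> {1..d} \<and> int (\<tau> r) < p r)" for \<tau> :: "nat \<Rightarrow> nat"
  define dup where "dup \<tau> = (THE k. int (\<tau> k) = p (row \<tau>))" for \<tau> :: "nat \<Rightarrow> nat"
  define g where "g \<tau> = \<tau> \<circ> Transposition.transpose (row \<tau>) (dup \<tau>)" for \<tau> :: "nat \<Rightarrow> nat"
  have ex: "\<exists>r k s. P \<tau> r k s" if \<tau>: "\<tau> \<in> ?N" for \<tau>
  proof -
    obtain r s where rs: "\<forall>i\<in>{1..d}. i \<noteq> r \<longrightarrow> i \<noteq> s \<longrightarrow> int (\<tau> i) = p i" "r \<in> {1..d}" "s \<in> {1..d}"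
      "int (\<tau> r) < p r" "p s < int (\<tau> s)" "int (\<tau> r) + int (\<tau> s) = p r + p s"
      using near_permE[OF \<tau> psum] by blast
    have perm: "\<tau> permutes {1..d}"
      using \<tau> by (auto simp: near_perms_def perms_below_def)
    \<comment> \<open>Here \<open>0 \<le> \<tau> r < p r \<le> w r \<le> d\<close>.\<close>
    have "nat (p r) \<in> {1..d}"
      using rs(2,4) wd[of r] pw[of r] by auto
    then obtain k where k: "k \<in> {1..d}" "\<tau> k = nat (p r)"
      using permutes_image[OF perm] by (metis imageE)
    have tk: "int (\<tau> k) = p r"
      using k(2) rs(4) by simp
    have "k \<noteq> r"
      using tk rs(4) by auto
    \<comment> \<open>If \<open>\<tau> s = p r\<close>, then equality of sums gives
      \<open>\<tau> r = p s\<close>, and swapping \<open>r\<close> and \<open>s\<close> yields a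
      permutation that agrees with \<open>p\<close>.\<close>
    have "k \<noteq> s"
    proof
      assume "k = s"
      define \<rho> where "\<rho> = \<tau> \<circ> Transposition.transpose r s"
      have "\<rho> permutes {1..d}"
        unfolding \<rho>_def using permutes_compose[OF permutes_swap_id perm] rs(2,3) by blast
      moreover have "int (\<rho> i) = p i" if "i \<in> {1..d}" for i
        using rs(1)[rule_format, OF that] rs(6) tk \<open>k = s\<close> unfolding \<rho>_def
        by (auto simp: Transposition.transpose_def)
      ultimately show False
        using nonperm by blast
    qed
    moreover have "p k = p r"
      using tk rs(1)[rule_format, OF k(1) \<open>k \<noteq> r\<close> \<open>k \<noteq> s\<close>] by simp
    ultimately show ?thesis
      using rs k(1) tk \<open>k \<noteq> r\<close> unfolding P_def by (intro exI[of _ r] exI[of _ k] exI[of _ s]) auto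
  qed
  have g_eq: "g \<tau> = \<tau> \<circ> Transposition.transpose r k" if \<tau>: "\<tau> permutes {1..d}" and P: "P \<tau> r k s" for \<tau> r k s
  proof -
    have "row \<tau> = r"
      unfolding row_def
    proof (rule the_equality)
      fix r' assume "r' \<in> {1..d} \<and> int (\<tau> r') < p r'"
      then show "r' = r" using P unfolding P_def by (metis less_irrefl less_asym)
    qed (use P in \<open>auto simp: P_def\<close>)
    moreover have "dup \<tau> = k"
      unfolding dup_def \<open>row \<tau> = r\<close>
    proof (rule the_equality)
      fix k' assume "int (\<tau> k') = p r"
      then have "\<tau> k' = \<tau> k"
        using P by (auto simp: P_def)
      then show "k' = k"
        using permutes_inj[OF \<tau>] by (auto dest: injD)
    qed (use P in \<open>auto simp: P_def\<close>)
    ultimately show ?thesis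
      by (simp add: g_def)
  qed
  have step: "g \<tau> \<in> ?N \<and> g (g \<tau>) = \<tau> \<and> sign (g \<tau>) = - sign \<tau>" if \<tau>: "\<tau> \<in> ?N" for \<tau>
  proof -
    obtain r k s where P: "P \<tau> r k s"
      using ex[OF \<tau>] by blast
    have perm: "\<tau> permutes {1..d}" and below: "\<And>i. i \<in> {1..d} \<Longrightarrow> int (\<tau> i) \<le> w i"
      using \<tau> by (auto simp: near_perms_def perms_below_def)
    have g: "g \<tau> = \<tau> \<circ> Transposition.transpose r k"
      by (rule g_eq[OF perm P])
    have gr: "g \<tau> r = \<tau> k" and gk: "g \<tau> k = \<tau> r" and gi: "\<And>i. i \<noteq> r \<Longrightarrow> i \<noteq> k \<Longrightarrow> g \<tau> i = \<tau> i"
      by (auto simp: g)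
    have gperm: "g \<tau> permutes {1..d}"
      unfolding g using permutes_compose[OF permutes_swap_id perm] P unfolding P_def by blast
    \<comment> \<open>At \<open>k\<close> the bound comes from the repeated value:
      \<open>\<tau> r < p r = p k \<le> w k\<close>.\<close>
    have gbelow: "int (g \<tau> i) \<le> w i" if "i \<in> {1..d}" for i
    proof -
      consider "i = r" | "i = k" | "i \<noteq> r" "i \<noteq> k" by blast
      then show ?thesis
      proof cases
        case 1
        then show ?thesis using gr pw[OF that] P by (auto simp: P_def)
      next
        case 2
        then show ?thesis using gk pw[OF that] P by (auto simp: P_def)
      next
        case 3
        then show ?thesis using gi below[OF that] by simp
      qed
    qed
    \<comment> \<open>Position \<open>r\<close> now carries \<open>p r\<close>, while
      \<open>k\<close> inherits the deficit because \<open>\<tau> r < p k\<close>; position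
      \<open>s\<close> is untouched.\<close>
    have D: "?D (g \<tau>) = {k, s}"
    proof -
      have "i \<in> ?D (g \<tau>) \<longleftrightarrow> i \<in> {k, s}" for i
      proof -
        consider "i = r" | "i = k" | "i \<noteq> r" "i \<noteq> k" by blast
        then show ?thesis
        proof cases
          case 1
          then show ?thesis using gr P by (auto simp: P_def)
        next
          case 2
          then show ?thesis using gk P by (auto simp: P_def)
        next
          case 3
          show ?thesis
          proof (cases "i = s")
            case True
            then show ?thesis using gi[OF 3] P by (simp add: P_def)
          next
            case False
            have "int (\<tau> i) = p i" if "i \<in> {1..d}"
              using that P 3(1) False unfolding P_def by blast
            then show ?thesis using gi[OF 3] 3(2) False by auto
          qed
        qed
      qed
      then show ?thesis by blast
    qed
    \<comment> \<open>The roles of \<open>r\<close> and \<open>k\<close> are exchanged, so a second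
      application of \<open>g\<close> makes the same swap and restores \<tau>.\<close>
    have Pg: "P (g \<tau>) k r s"
    proof -
      have "\<forall>i\<in>{1..d}. i \<noteq> k \<longrightarrow> i \<noteq> s \<longrightarrow> int (g \<tau> i) = p i"
        using D by blast
      moreover have "g \<tau> s = \<tau> s"
        using gi P by (auto simp: P_def)
      ultimately show ?thesis
        using P gr gk by (simp add: P_def)
    qed
    have "card (?D (g \<tau>)) = 2"
      unfolding D using P by (auto simp: P_def)
    then have "g \<tau> \<in> ?N"
      using gperm gbelow by (simp add: near_perms_def perms_below_def)
    moreover have "g (g \<tau>) = \<tau>"
      using g_eq[OF gperm Pg] by (simp add: g fun_eq_iff Transposition.transpose_commute[of k r])
    moreover have "sign (g \<tau>) = - sign \<tau>"
      unfolding g using P by (intro sign_compose_transpose[OF perm]) (auto simp: P_def)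
    ultimately show ?thesis by blast
  qed
  have "(\<Sum>\<tau>\<in>?N. sign \<tau>) = (\<Sum>\<tau>\<in>?N. - sign \<tau>)"
    by (rule sum.reindex_bij_witness[where i = g and j = g]) (use step in auto)
  then show ?thesis
    by (simp add: sum_negf)
qed

text \<open>
  A pair \<open>i, k\<close> with \<open>\<rho> i < \<rho> k\<close> may be swapped as soon as \<open>\<rho> k \<le> w i\<close>, because
  \<open>\<rho> i < \<rho> k \<le> w k\<close> holds anyway.
\<close>

lemma sum_sign_near_perms_perm:
  assumes wd: "\<And>i. i \<in> {1..d} \<Longrightarrow> w i \<le> int d"
    and \<rho>: "\<rho> \<in> perms_below d w"
  shows "(\<Sum>\<tau>\<in>near_perms d w (\<lambda>i. int (\<rho> i)). sign \<tau>) =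
    - ((\<Sum>i=1..d. w i) - (\<Sum>i=1..d. int i)) * sign \<rho>"
proof -
  let ?p = "\<lambda>i. int (\<rho> i)"
  let ?N = "near_perms d w ?p"
  define K where "K i = {k\<in>{1..d}. \<rho> i < \<rho> k \<and> int (\<rho> k) \<le> w i}" for i
  define S where "S = Sigma {1..d} K"
  define h where "h = (\<lambda>(i, k). \<rho> \<circ> Transposition.transpose i k)"
  have perm: "\<rho> permutes {1..d}" and below: "\<And>i. i \<in> {1..d} \<Longrightarrow> ?p i \<le> w i"
    using \<rho> by (auto simp: perms_below_def)
  note inj = permutes_inj[OF perm]
  have rsum: "(\<Sum>i=1..d. ?p i) = (\<Sum>i=1..d. int i)"
    by (rule sum.permute[OF perm, of int, symmetric, unfolded o_def])
  \<comment> \<open>The orientation \<open>\<rho> i < \<rho> k\<close> makes \<open>i\<close> the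
    only position where the swap raises the value, so evaluation at \<open>i\<close> separates the
    pairs.\<close>
  have inj_h: "inj_on h S"
  proof (rule inj_onI)
    fix a b assume ab: "a \<in> S" "b \<in> S" "h a = h b"
    obtain i k where a: "a = (i, k)" by (cases a)
    obtain i' k' where b: "b = (i', k')" by (cases b)
    have lt: "\<rho> i < \<rho> k" "\<rho> i' < \<rho> k'" "i \<noteq> k" "i' \<noteq> k'"
      using ab by (auto simp: a b S_def K_def)
    have eq: "\<rho> (Transposition.transpose i k j) = \<rho> (Transposition.transpose i' k' j)" for j
      using ab(3) by (auto simp: a b h_def fun_eq_iff)
    have "i = i'"
    proof (rule ccontr)
      assume "i \<noteq> i'"
      then show False
        using eq[of i] lt by (cases "i = k'") auto
    qed
    moreover have "k = k'"
      using eq[of i] \<open>i = i'\<close> by (auto dest: injD[OF inj])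
    ultimately show "a = b" by (simp add: a b)
  qed
  have img: "h ` S = ?N"
  proof
    show "h ` S \<subseteq> ?N"
    proof clarify
      fix i k assume "(i, k) \<in> S"
      then have ik: "i \<in> {1..d}" "k \<in> {1..d}" "\<rho> i < \<rho> k" "int (\<rho> k) \<le> w i"
        by (auto simp: S_def K_def)
      have "h (i, k) permutes {1..d}"
        unfolding h_def using permutes_compose[OF permutes_swap_id perm] ik by auto
      moreover have "int (h (i, k) j) \<le> w j" if "j \<in> {1..d}" for j
        using below[OF that] ik below[of k] by (auto simp: h_def Transposition.transpose_def)
      moreover have "{j\<in>{1..d}. int (h (i, k) j) \<noteq> ?p j} = {i, k}"
        using ik by (auto simp: h_def Transposition.transpose_def)
      ultimately show "h (i, k) \<in> ?N"
        using ik(3) by (auto simp: near_perms_def perms_below_def card_2_iff)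
    qed
    show "?N \<subseteq> h ` S"
    proof
      fix \<tau> assume \<tau>: "\<tau> \<in> ?N"
      obtain r s where rs: "\<forall>i\<in>{1..d}. i \<noteq> r \<longrightarrow> i \<noteq> s \<longrightarrow> int (\<tau> i) = ?p i" "r \<in> {1..d}" "s \<in> {1..d}"
        "int (\<tau> r) < ?p r" "?p s < int (\<tau> s)" "int (\<tau> r) + int (\<tau> s) = ?p r + ?p s"
        using near_permE[OF \<tau> rsum] by blast
      have tperm: "\<tau> permutes {1..d}" and tbelow: "\<And>i. i \<in> {1..d} \<Longrightarrow> int (\<tau> i) \<le> w i"
        using \<tau> by (auto simp: near_perms_def perms_below_def)
      have "\<tau> r \<in> {1..d}"
        using permutes_in_image[OF tperm] rs(2) by blast
      then obtain k where k: "k \<in> {1..d}" "\<rho> k = \<tau> r"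
        using permutes_image[OF perm] by (metis imageE)
      have off: "\<tau> i = \<rho> i" if "i \<noteq> r" "i \<noteq> s" for i
      proof (cases "i \<in> {1..d}")
        case True
        then show ?thesis using rs(1)[rule_format, OF True that] by simp
      next
        case False
        then show ?thesis using perm tperm by (simp add: permutes_def)
      qed
      \<comment> \<open>Off \<open>r\<close> and \<open>s\<close>, \<tau> agrees with \<rho>; so
        \<open>k \<noteq> s\<close> would give \<open>\<tau> k = \<rho> k = \<tau> r\<close> with
        \<open>k \<noteq> r\<close>.\<close>
      have "k = s"
      proof (rule ccontr)
        assume "k \<noteq> s"
        moreover have "k \<noteq> r" using k(2) rs(4) by auto
        ultimately have "\<tau> k = \<tau> r" using off k by simp
        then show False
          using \<open>k \<noteq> r\<close> permutes_inj[OF tperm] by (auto dest: injD)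
      qed
      then have vals: "\<tau> r = \<rho> s" "\<tau> s = \<rho> r"
        using k(2) rs(6) by auto
      \<comment> \<open>The excess position comes first:
        \<open>\<rho> s < \<rho> r = \<tau> s \<le> w s\<close> is exactly the condition for
        \<open>(s, r)\<close> to lie in \<open>S\<close>.\<close>
      have "\<tau> = h (s, r)"
        unfolding h_def using off vals by (auto simp: fun_eq_iff Transposition.transpose_def)
      moreover have "(s, r) \<in> S"
        using rs(2-5) vals tbelow[of s] by (auto simp: S_def K_def)
      ultimately show "\<tau> \<in> h ` S" by blast
    qed
  qed
  \<comment> \<open>As \<open>w i \<le> d\<close>, every integer above \<open>\<rho> i\<close> and
    up to \<open>w i\<close> is a value of \<rho>.\<close>
  have cardK: "int (card (K i)) = w i - ?p i" if i: "i \<in> {1..d}" for i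
  proof -
    have "(\<lambda>k. int (\<rho> k)) ` K i = {?p i<..w i}"
    proof
      show "{?p i<..w i} \<subseteq> (\<lambda>k. int (\<rho> k)) ` K i"
      proof
        fix v assume v: "v \<in> {?p i<..w i}"
        then have "nat v \<in> {1..d}" using wd[OF i] by auto
        then obtain k where k: "k \<in> {1..d}" "\<rho> k = nat v"
          using permutes_image[OF perm] by (metis imageE)
        then show "v \<in> (\<lambda>k. int (\<rho> k)) ` K i"
          using v by (intro image_eqI[of _ _ k]) (auto simp: K_def)
      qed
    qed (auto simp: K_def)
    moreover have "inj_on (\<lambda>k. int (\<rho> k)) (K i)"
      by (auto intro!: inj_onI dest: injD[OF inj])
    ultimately have "card (K i) = card {?p i<..w i}"
      by (metis card_image)
    then show ?thesis
      using below[OF i] by simp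
  qed
  have "(\<Sum>\<tau>\<in>?N. sign \<tau>) = (\<Sum>a\<in>S. sign (h a))"
    unfolding img[symmetric] by (simp add: sum.reindex[OF inj_h])
  also have "\<dots> = (\<Sum>a\<in>S. - sign \<rho>)"
    by (rule sum.cong) (auto simp: S_def K_def h_def intro!: sign_compose_transpose[OF perm])
  also have "\<dots> = - int (card S) * sign \<rho>"
    by simp
  also have "int (card S) = (\<Sum>i=1..d. w i - ?p i)"
    unfolding S_def by (subst card_SigmaI) (auto simp: K_def[symmetric] cardK, auto simp: K_def)
  also have "\<dots> = (\<Sum>i=1..d. w i) - (\<Sum>i=1..d. int i)"
    using rsum by (simp add: sum_subtractf)
  finally show ?thesis .
qed

section \<open>Inversion words\<close>

text \<open>Only \<open>d - i\<close> positions lie to the right of \<open>i\<close>. This supplies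
  the upper bound on \<open>w\<close> for the signed counts.\<close>

lemma inversion_word_le:
  assumes "i \<in> {1..d}"
  shows "int (inversion_word d \<pi> i) + int i \<le> int d"
proof -
  have "inversion_word d \<pi> i \<le> card {i<..d}"
    unfolding inversion_word_def by (rule card_mono) auto
  then show ?thesis using assms by auto
qed

lemma inversion_word_outside:
  assumes "\<pi> permutes {1..d}" "i \<notin> {1..d}"
  shows "inversion_word d \<pi> i = 0"
proof -
  have "\<pi> i = i" using assms by (simp add: permutes_def)
  then have "{j\<in>{1..d}. i < j \<and> \<pi> i > \<pi> j} = {}"
    using assms(2) by auto
  then show ?thesis by (simp only: inversion_word_def card.empty)
qed

lemma sum_inversion_word: "(\<Sum>i=1..d. inversion_word d \<pi> i) = card (inversions d \<pi>)"
proof -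
  have "inversions d \<pi> = Sigma {1..d} (\<lambda>i. {j\<in>{1..d}. i < j \<and> \<pi> i > \<pi> j})"
    by (auto simp: inversions_def)
  then show ?thesis
    by (simp add: inversion_word_def)
qed

lemma inversion_word_eq_card_values:
  assumes "\<pi> permutes {1..d}" "i \<in> {1..d}"
  shows "inversion_word d \<pi> i = card {v \<in> {1..d} - \<pi> ` {1..<i}. v < \<pi> i}"
proof -
  note inj = permutes_inj[OF assms(1)]
  have img: "\<pi> ` {j\<in>{1..d}. i < j \<and> \<pi> i > \<pi> j} = {v \<in> {1..d} - \<pi> ` {1..<i}. v < \<pi> i}"
  proof
    show "\<pi> ` {j\<in>{1..d}. i < j \<and> \<pi> i > \<pi> j} \<subseteq> {v \<in> {1..d} - \<pi> ` {1..<i}. v < \<pi> i}"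
    proof
      fix v assume "v \<in> \<pi> ` {j\<in>{1..d}. i < j \<and> \<pi> i > \<pi> j}"
      then obtain j where j: "j \<in> {1..d}" "i < j" "\<pi> j < \<pi> i" "v = \<pi> j" by blast
      have "v \<noteq> \<pi> l" if "l < i" for l
        using that j injD[OF inj, of j l] by auto
      then have "v \<notin> \<pi> ` {1..<i}"
        by (metis atLeastLessThan_iff imageE)
      then show "v \<in> {v \<in> {1..d} - \<pi> ` {1..<i}. v < \<pi> i}"
        using j permutes_in_image[OF assms(1), of j] by auto
    qed
    show "{v \<in> {1..d} - \<pi> ` {1..<i}. v < \<pi> i} \<subseteq> \<pi> ` {j\<in>{1..d}. i < j \<and> \<pi> i > \<pi> j}"
    proof
      fix v assume v: "v \<in> {v \<in> {1..d} - \<pi> ` {1..<i}. v < \<pi> i}"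
      then obtain j where j: "j \<in> {1..d}" "v = \<pi> j"
        using permutes_image[OF assms(1)] by blast
      then have "\<not> j < i" "j \<noteq> i" using v by auto
      then show "v \<in> \<pi> ` {j\<in>{1..d}. i < j \<and> \<pi> i > \<pi> j}" using v j by auto
    qed
  qed
  have "inj_on \<pi> {j\<in>{1..d}. i < j \<and> \<pi> i > \<pi> j}"
    using inj by (rule inj_on_subset) simp
  from card_image[OF this] show ?thesis
    unfolding inversion_word_def img by (rule sym)
qed

lemma inversion_word_inj:
  assumes \<pi>: "\<pi> permutes {1..d}" and \<rho>: "\<rho> permutes {1..d}"
    and eq: "inversion_word d \<pi> = inversion_word d \<rho>"
  shows "\<pi> = \<rho>"
proof -
  have "\<pi> i = \<rho> i" if "i \<in> {1..d}" for i
    using that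
  proof (induction i rule: less_induct)
    case (less i)
    let ?R = "{1..d} - \<pi> ` {1..<i}"
    have R: "\<pi> ` {1..<i} = \<rho> ` {1..<i}"
      using less by (intro image_cong) auto
    have fresh: "\<sigma> i \<in> {1..d} - \<sigma> ` {1..<i}" if "\<sigma> permutes {1..d}" for \<sigma>
      using less.prems permutes_in_image[OF that] injD[OF permutes_inj[OF that]] by force
    have mem: "\<pi> i \<in> ?R" "\<rho> i \<in> ?R"
      using fresh[OF \<pi>] fresh[OF \<rho>] R by auto
    have card_eq: "card {v\<in>?R. v < \<pi> i} = card {v\<in>?R. v < \<rho> i}"
      using inversion_word_eq_card_values[OF \<pi> less.prems]
        inversion_word_eq_card_values[OF \<rho> less.prems] eq R by simp
    \<comment> \<open>The larger value \<open>b\<close> has \<open>a\<close> itself below it in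
      addition to everything below \<open>a\<close>.\<close>
    have strict: "card {v\<in>?R. v < a} < card {v\<in>?R. v < b}" if "a < b" "a \<in> ?R" for a b
      using that by (intro psubset_card_mono) auto
    show ?case
      using strict[of "\<pi> i" "\<rho> i"] strict[of "\<rho> i" "\<pi> i"] mem card_eq
      by (cases "\<pi> i" "\<rho> i" rule: linorder_cases) auto
  qed
  moreover have "\<pi> i = \<rho> i" if "i \<notin> {1..d}" for i
    using that \<pi> \<rho> by (simp add: permutes_def)
  ultimately show ?thesis by blast
qed

section \<open>Coordinates of vectors\<close>

lemma lookup_scaleR [simp]:
  fixes v :: "'a \<Rightarrow>\<^sub>0 'b::real_vector"
  shows "Poly_Mapping.lookup (c *\<^sub>R v) x = c *\<^sub>R Poly_Mapping.lookup v x"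
proof -
  have "finite {i. c *\<^sub>R Poly_Mapping.lookup v i \<noteq> 0}"
    by (rule finite_subset[OF _ finite_lookup[of v]]) auto
  then show ?thesis
    by (simp add: scaleR_poly_mapping_def Abs_poly_mapping_inverse)
qed

lemma lookup_basis_vec: "Poly_Mapping.lookup (basis_vec x) y = (if x = y then 1 else 0)"
  by (simp add: basis_vec_def lookup_single when_def)

lemma lookup_SR_A:
  "Poly_Mapping.lookup (SR_A d n v) y =
    (\<Sum>x | SR_adj d n y x. Poly_Mapping.lookup v x)"
proof -
  let ?c = "\<lambda>y. \<Sum>x\<in>SR_verts d n. SR_adjacency_matrix d n y x * Poly_Mapping.lookup v x"
  have "Poly_Mapping.lookup (SR_A d n v) y = (\<Sum>z\<in>SR_verts d n. if z = y then ?c z else 0)"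
    unfolding SR_A_def lookup_sum by (rule sum.cong) (auto simp: lookup_basis_vec)
  also have "\<dots> = (if y \<in> SR_verts d n then ?c y else 0)"
    by (simp add: finite_SR_verts)
  \<comment> \<open>For \<open>y\<close> outside the vertex set the row vanishes, since adjacency
    includes membership.\<close>
  also have "\<dots> = ?c y"
    by (auto simp: SR_adjacency_matrix_def SR_adj_def)
  also have "\<dots> = (\<Sum>x | SR_adj d n y x. Poly_Mapping.lookup v x)"
    by (rule sum.mono_neutral_cong_right)
      (auto simp: finite_SR_verts SR_adjacency_matrix_def SR_adj_def)
  finally show ?thesis .
qed

section \<open>Dimension bounds and triangular families\<close>

lemma SR_space_subset_span: "SR_space d n \<subseteq> span (basis_vec ` SR_verts d n)"
proof
  fix v assume v: "v \<in> SR_space d n"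
  have "v = (\<Sum>x\<in>SR_verts d n. Poly_Mapping.lookup v x *\<^sub>R basis_vec x)"
  proof (rule poly_mapping_eqI)
    fix y
    have "Poly_Mapping.lookup (\<Sum>x\<in>SR_verts d n. Poly_Mapping.lookup v x *\<^sub>R basis_vec x) y =
        (\<Sum>x\<in>SR_verts d n. if x = y then Poly_Mapping.lookup v x else 0)"
      unfolding lookup_sum by (rule sum.cong) (auto simp: lookup_basis_vec)
    also have "\<dots> = (if y \<in> SR_verts d n then Poly_Mapping.lookup v y else 0)"
      by (simp add: finite_SR_verts)
    also have "\<dots> = Poly_Mapping.lookup v y"
      using v by (auto simp: SR_space_def in_keys_iff)
    finally show "Poly_Mapping.lookup v y =
        Poly_Mapping.lookup (\<Sum>x\<in>SR_verts d n. Poly_Mapping.lookup v x *\<^sub>R basis_vec x) y" ..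
  qed
  also have "\<dots> \<in> span (basis_vec ` SR_verts d n)"
    by (intro span_sum span_scale span_base imageI)
  finally show "v \<in> span (basis_vec ` SR_verts d n)" .
qed

text \<open>The ambient space of finitely supported functions is infinite-dimensional. The finite
  set \<open>T\<close> ensures that a basis realising \<open>dim V\<close> is finite, so that its
  cardinality bounds that of \<open>B\<close>.\<close>

lemma card_le_dim_of_finite_span:
  fixes V :: "'a::real_vector set"
  assumes "finite T" "V \<subseteq> span T" "independent B" "B \<subseteq> V"
  shows "card B \<le> dim V"
proof -
  obtain C where C: "C \<subseteq> V" "independent C" "V \<subseteq> span C" "card C = dim V"
    using basis_exists[of V] by blast
  have "finite C"
    using independent_span_bound[OF assms(1) C(2)] C(1) assms(2) by blast
  then show ?thesis
    using independent_span_bound[of C B] assms C by auto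
qed

text \<open>In a vanishing combination, choose \<open>i\<close> with least \<open>\<phi> i\<close>
  among the indices with nonzero coefficient. At the coordinate \<open>m i\<close> only the term of
  \<open>i\<close> survives. If \<open>F i = F j\<close> with \<open>i \<noteq> j\<close>, both
  strict inequalities would hold.\<close>

lemma triangular_family_independent:
  fixes F :: "'i \<Rightarrow> ('a \<Rightarrow>\<^sub>0 real)" and m :: "'i \<Rightarrow> 'a" and \<phi> :: "'i \<Rightarrow> 'b::linorder"
  assumes fin: "finite I"
    and diag: "\<And>i. i \<in> I \<Longrightarrow> Poly_Mapping.lookup (F i) (m i) \<noteq> 0"
    and tri: "\<And>i j. i \<in> I \<Longrightarrow> j \<in> I \<Longrightarrow> i \<noteq> j \<Longrightarrow>
      Poly_Mapping.lookup (F j) (m i) \<noteq> 0 \<Longrightarrow> \<phi> j < \<phi> i"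
  shows "inj_on F I" and "independent (F ` I)"
proof -
  show inj: "inj_on F I"
  proof (rule inj_onI, rule ccontr)
    fix i j assume ij: "i \<in> I" "j \<in> I" "F i = F j" "i \<noteq> j"
    then have "\<phi> j < \<phi> i" "\<phi> i < \<phi> j"
      using tri[of i j] tri[of j i] diag[of i] diag[of j] by auto
    then show False by simp
  qed
  show "independent (F ` I)"
  proof
    assume "dependent (F ` I)"
    then obtain u where u: "\<exists>v\<in>F ` I. u v \<noteq> 0" "(\<Sum>v\<in>F ` I. u v *\<^sub>R v) = 0"
      using dependent_finite[of "F ` I"] fin by auto
    define S where "S = {i\<in>I. u (F i) \<noteq> 0}"
    have S: "finite S" "S \<noteq> {}"
      using fin u(1) by (auto simp: S_def)
    define i where "i = arg_min_on \<phi> S"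
    have i: "i \<in> S" and min: "\<And>j. j \<in> S \<Longrightarrow> \<not> \<phi> j < \<phi> i"
      using arg_min_if_finite[OF S, of \<phi>] unfolding i_def by auto
    have "(\<Sum>j\<in>I. u (F j) *\<^sub>R F j) = 0"
      using u(2) by (simp add: sum.reindex[OF inj])
    then have "0 = Poly_Mapping.lookup (\<Sum>j\<in>I. u (F j) *\<^sub>R F j) (m i)"
      by simp
    also have "\<dots> = (\<Sum>j\<in>I. u (F j) * Poly_Mapping.lookup (F j) (m i))"
      by (simp add: lookup_sum)
    also have "\<dots> = (\<Sum>j\<in>{i}. u (F j) * Poly_Mapping.lookup (F j) (m i))"
    proof (rule sum.mono_neutral_right[OF fin])
      show "\<forall>j\<in>I - {i}. u (F j) * Poly_Mapping.lookup (F j) (m i) = 0"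
      proof
        fix j assume "j \<in> I - {i}"
        then show "u (F j) * Poly_Mapping.lookup (F j) (m i) = 0"
          using tri[of i j] min[of j] i by (auto simp: S_def)
      qed
    qed (use i in \<open>auto simp: S_def\<close>)
    finally show False
      using diag[of i] i by (auto simp: S_def)
  qed
qed

section \<open>The partial permutohedron vectors\<close>

lemma admissible_eq_perms_below:
  "admissible d \<pi> = perms_below d (\<lambda>i. int (inversion_word d \<pi> i) + int i)"
  by (auto simp: admissible_def perms_below_def)

lemma perm_point_inj:
  assumes "perm_point d \<pi> \<sigma> = perm_point d \<pi> \<tau>"
  shows "\<sigma> = \<tau>"
proof
  fix i
  show "\<sigma> i = \<tau> i"
    using fun_cong[OF assms, of i] by (simp add: perm_point_def)
qed

lemma perm_point_in_SR_verts:
  assumes "\<pi> \<in> perms_inv d n" "\<sigma> \<in> admissible d \<pi>"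
  shows "perm_point d \<pi> \<sigma> \<in> SR_verts d n"
proof -
  have \<pi>: "\<pi> permutes {1..d}" and n: "card (inversions d \<pi>) = n"
    using assms(1) by (auto simp: perms_inv_def)
  have \<sigma>: "\<sigma> permutes {1..d}"
    using assms(2) by (simp add: admissible_def)
  have "(\<Sum>i=1..d. int (\<sigma> i)) = (\<Sum>i=1..d. int i)"
    by (rule sum.permute[OF \<sigma>, of int, symmetric, unfolded o_def])
  then have "(\<Sum>i=1..d. perm_point d \<pi> \<sigma> i) = int (\<Sum>i=1..d. inversion_word d \<pi> i)"
    by (simp add: perm_point_def sum_subtractf sum.distrib)
  then have "(\<Sum>i=1..d. perm_point d \<pi> \<sigma> i) = int n"
    using n by (simp only: sum_inversion_word)
  moreover have "perm_point d \<pi> \<sigma> i = 0" if "i \<notin> {1..d}" for i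
  proof -
    have "\<sigma> i = i" using \<sigma> that by (simp add: permutes_def)
    then show ?thesis
      using inversion_word_outside[OF \<pi> that] by (simp add: perm_point_def)
  qed
  moreover have "0 \<le> perm_point d \<pi> \<sigma> i" if "i \<in> {1..d}" for i
    using assms(2) that by (simp add: admissible_def perm_point_def)
  ultimately show ?thesis
    by (simp add: SR_verts_def)
qed

text \<open>The coefficient is kept as a sum, though \<open>perm_point_inj\<close> leaves at most
  one term, so that a sum over neighbours can be regrouped as a sum over permutations.\<close>

lemma lookup_partial_permutohedron_vec:
  "Poly_Mapping.lookup (partial_permutohedron_vec d \<pi>) x =
    of_int (\<Sum>\<sigma> | \<sigma> \<in> admissible d \<pi> \<and> perm_point d \<pi> \<sigma> = x. sign \<sigma>)"
proof -
  have "Poly_Mapping.lookup (partial_permutohedron_vec d \<pi>) x =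
      (\<Sum>\<sigma>\<in>admissible d \<pi>. if perm_point d \<pi> \<sigma> = x then of_int (sign \<sigma>) else 0)"
    unfolding partial_permutohedron_vec_def lookup_sum
    by (rule sum.cong) (auto simp: lookup_basis_vec)
  also have "\<dots> = (\<Sum>\<sigma> | \<sigma> \<in> admissible d \<pi> \<and> perm_point d \<pi> \<sigma> = x. of_int (sign \<sigma>))"
    by (subst sum.inter_filter) (auto simp: admissible_eq_perms_below)
  finally show ?thesis by simp
qed

lemma lookup_partial_permutohedron_vec_perm_point:
  assumes "\<sigma> \<in> admissible d \<pi>"
  shows "Poly_Mapping.lookup (partial_permutohedron_vec d \<pi>) (perm_point d \<pi> \<sigma>) = of_int (sign \<sigma>)"
proof -
  have "{\<tau>. \<tau> \<in> admissible d \<pi> \<and> perm_point d \<pi> \<tau> = perm_point d \<pi> \<sigma>} = {\<sigma>}"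
    using assms perm_point_inj by auto
  then show ?thesis
    by (simp add: lookup_partial_permutohedron_vec)
qed

text \<open>The point of \<open>id\<close> is the inversion word; its coefficient 1 shows that the
  vector is nonzero and later serves as leading coefficient.\<close>

lemma id_admissible: "id \<in> admissible d \<pi>"
  by (simp add: admissible_def permutes_id)

section \<open>The eigenvalue equation, coordinate by coordinate\<close>

lemma partial_permutohedron_vec_in_SR_space:
  assumes "\<pi> \<in> perms_inv d n"
  shows "partial_permutohedron_vec d \<pi> \<in> SR_space d n"
proof -
  have "x \<in> SR_verts d n" if "x \<in> Poly_Mapping.keys (partial_permutohedron_vec d \<pi>)" for x
  proof -
    have "{\<sigma>. \<sigma> \<in> admissible d \<pi> \<and> perm_point d \<pi> \<sigma> = x} \<noteq> {}"
      using that unfolding in_keys_iff lookup_partial_permutohedron_vec by (metis sum.empty of_int_0)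
    then show ?thesis
      using perm_point_in_SR_verts[OF assms] by blast
  qed
  then show ?thesis by (auto simp: SR_space_def)
qed

lemma SR_A_partial_permutohedron_vec:
  assumes \<pi>: "\<pi> \<in> perms_inv d n"
  shows "SR_A d n (partial_permutohedron_vec d \<pi>) = (- real n) *\<^sub>R partial_permutohedron_vec d \<pi>"
proof (rule poly_mapping_eqI)
  fix y
  let ?F = "partial_permutohedron_vec d \<pi>"
  define w where "w i = int (inversion_word d \<pi> i) + int i" for i
  define p where "p i = w i - y i" for i
  have Adm: "admissible d \<pi> = perms_below d w"
    by (simp add: admissible_eq_perms_below w_def[abs_def])
  have pp: "perm_point d \<pi> \<sigma> i = w i - int (\<sigma> i)" for \<sigma> i
    by (simp add: perm_point_def w_def)
  have perm: "\<pi> permutes {1..d}"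
    using \<pi> by (simp add: perms_inv_def)
  have wd: "w i \<le> int d" if "i \<in> {1..d}" for i
    using inversion_word_le[OF that] by (simp add: w_def)
  have "(\<Sum>i=1..d. w i) = int (\<Sum>i=1..d. inversion_word d \<pi> i) + (\<Sum>i=1..d. int i)"
    by (simp add: w_def sum.distrib)
  \<comment> \<open>The eigenvalue originates here: \<open>w\<close> exceeds the identity by
    \<open>n\<close> in total, the number of inversions.\<close>
  then have wsum: "(\<Sum>i=1..d. w i) = int n + (\<Sum>i=1..d. int i)"
    using \<pi> by (simp only: sum_inversion_word) (simp add: perms_inv_def)
  show "Poly_Mapping.lookup (SR_A d n ?F) y = Poly_Mapping.lookup ((- real n) *\<^sub>R ?F) y"
  proof (cases "y \<in> SR_verts d n")
    case False
    then have "Poly_Mapping.lookup ?F y = 0"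
      using partial_permutohedron_vec_in_SR_space[OF \<pi>] by (auto simp: SR_space_def in_keys_iff)
    then show ?thesis
      using False by (simp add: lookup_SR_A SR_adj_def)
  next
    case y: True
    have fin: "finite {x. SR_adj d n y x}"
      by (rule finite_subset[OF _ finite_SR_verts[of d n]]) (auto simp: SR_adj_def)
    \<comment> \<open>Both \<open>y\<close> and the point of \<sigma> arise by subtraction from
      \<open>w\<close>, so they differ exactly where \<open>p\<close> and \<sigma> do.\<close>
    have adj: "SR_adj d n y (perm_point d \<pi> \<sigma>) \<longleftrightarrow> \<sigma> \<in> near_perms d w p"
      if "\<sigma> \<in> perms_below d w" for \<sigma>
    proof -
      have "{i\<in>{1..d}. y i \<noteq> perm_point d \<pi> \<sigma> i} = {i\<in>{1..d}. int (\<sigma> i) \<noteq> p i}"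
        by (auto simp: pp p_def)
      then show ?thesis
        using that y perm_point_in_SR_verts[OF \<pi>, of \<sigma>]
        by (simp add: SR_adj_def near_perms_def Adm)
    qed
    have "Poly_Mapping.lookup (SR_A d n ?F) y =
        of_int (\<Sum>x | SR_adj d n y x. \<Sum>\<sigma> | \<sigma> \<in> perms_below d w \<and> perm_point d \<pi> \<sigma> = x. sign \<sigma>)"
      by (simp add: lookup_SR_A lookup_partial_permutohedron_vec Adm)
    also have "(\<Sum>x | SR_adj d n y x. \<Sum>\<sigma> | \<sigma> \<in> perms_below d w \<and> perm_point d \<pi> \<sigma> = x. sign \<sigma>) =
        (\<Sum>x | SR_adj d n y x. \<Sum>\<sigma> | \<sigma> \<in> near_perms d w p \<and> perm_point d \<pi> \<sigma> = x. sign \<sigma>)"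
      by (intro sum.cong refl Collect_cong) (use adj in \<open>auto simp: near_perms_def\<close>)
    also have "\<dots> = (\<Sum>\<sigma>\<in>near_perms d w p. sign \<sigma>)"
      by (rule sum.group[OF finite_near_perms fin]) (use adj in \<open>auto simp: near_perms_def\<close>)
    finally have A: "Poly_Mapping.lookup (SR_A d n ?F) y = of_int (\<Sum>\<sigma>\<in>near_perms d w p. sign \<sigma>)" .
    show ?thesis
    proof (cases "\<exists>\<rho>. \<rho> permutes {1..d} \<and> (\<forall>i\<in>{1..d}. int (\<rho> i) = p i)")
      case True
      then obtain \<rho> where \<rho>: "\<rho> permutes {1..d}" "\<And>i. i \<in> {1..d} \<Longrightarrow> int (\<rho> i) = p i"
        by blast
      \<comment> \<open>Outside \<open>{1..d}\<close> both \<open>y\<close> and the inversion word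
        vanish, so \<open>p\<close> is the identity there like \<rho>, and the two agree as
        functions.\<close>
      have out: "p i = int (\<rho> i)" if "i \<notin> {1..d}" for i
      proof -
        have "\<rho> i = i" using \<rho>(1) that by (simp add: permutes_def)
        moreover have "y i = 0" using y that unfolding SR_verts_def by blast
        ultimately show ?thesis
          using inversion_word_outside[OF perm that] by (simp add: p_def w_def)
      qed
      have p: "p = (\<lambda>i. int (\<rho> i))"
        using out \<rho>(2) by (metis ext)
      have below: "\<rho> \<in> perms_below d w"
        using \<rho> y by (auto simp: perms_below_def p_def SR_verts_def)
      have "perm_point d \<pi> \<rho> = y"
      proof
        fix i
        show "perm_point d \<pi> \<rho> i = y i"
          using fun_cong[OF p, of i] by (simp add: pp p_def)
      qed
      then have "Poly_Mapping.lookup ?F y = of_int (sign \<rho>)"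
        using lookup_partial_permutohedron_vec_perm_point[of \<rho> d \<pi>] below Adm by auto
      then show ?thesis
        using sum_sign_near_perms_perm[OF wd below] A unfolding wsum p by simp
    next
      case False
      \<comment> \<open>A permutation with point \<open>y\<close> would agree with \<open>p\<close>,
        so \<open>y\<close> is off the support.\<close>
      have "{\<sigma>. \<sigma> \<in> admissible d \<pi> \<and> perm_point d \<pi> \<sigma> = y} = {}"
      proof -
        have "int (\<sigma> i) = p i" if "perm_point d \<pi> \<sigma> = y" for \<sigma> i
          using that pp[of \<sigma> i] by (simp add: p_def)
        then show ?thesis
          using False unfolding admissible_def by blast
      qed
      then have "Poly_Mapping.lookup ?F y = 0"
        by (simp only: lookup_partial_permutohedron_vec) simp
      moreover have "(\<Sum>\<sigma>\<in>near_perms d w p. sign \<sigma>) = 0"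
      proof (rule sum_sign_near_perms_nonperm[OF wd _ _ False])
        show "p i \<le> w i" if "i \<in> {1..d}" for i
          using y that by (auto simp: p_def SR_verts_def)
        show "(\<Sum>i=1..d. p i) = (\<Sum>i=1..d. int i)"
          using y wsum by (simp add: p_def sum_subtractf SR_verts_def)
      qed
      ultimately show ?thesis
        using A by simp
    qed
  qed
qed

lemma partial_permutohedron_vec_nonzero: "partial_permutohedron_vec d \<pi> \<noteq> 0"
proof
  assume "partial_permutohedron_vec d \<pi> = 0"
  then show False
    using lookup_partial_permutohedron_vec_perm_point[OF id_admissible[of d \<pi>]] by simp
qed

section \<open>Linear independence and the dimension bound\<close>

text \<open>
  Since \<open>\<Sum>i. i * (i - \<sigma> i) = (\<Sum>i. (i - \<sigma> i)\<^sup>2) / 2\<close>, the functional \<open>x \<mapsto> \<Sum>i. i * x i\<close>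
  attains its minimum over the support of a partial permutohedron vector only at the
  inversion word.
\<close>

lemma weighted_sum_perm_point_less:
  assumes \<sigma>: "\<sigma> permutes {1..d}" and "\<sigma> \<noteq> id"
  shows "(\<Sum>i=1..d. int i * perm_point d \<pi> id i) < (\<Sum>i=1..d. int i * perm_point d \<pi> \<sigma> i)"
proof -
  have sq: "(\<Sum>i=1..d. (int (\<sigma> i))\<^sup>2) = (\<Sum>i=1..d. (int i)\<^sup>2)"
    by (rule sum.permute[OF \<sigma>, of "\<lambda>i. (int i)\<^sup>2", symmetric, unfolded o_def])
  obtain k where k: "\<sigma> k \<noteq> k" using \<open>\<sigma> \<noteq> id\<close> by (auto simp: fun_eq_iff)
  then have "k \<in> {1..d}" using \<sigma> by (auto simp: permutes_def)
  then have "0 < (\<Sum>i=1..d. (int i - int (\<sigma> i))\<^sup>2)"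
    using k by (intro sum_pos2[of _ k]) auto
  also have "\<dots> = (\<Sum>i=1..d. (int i)\<^sup>2 + (int (\<sigma> i))\<^sup>2 - 2 * (int i * int (\<sigma> i)))"
    by (intro sum.cong) (auto simp: power2_diff)
  also have "\<dots> = 2 * (\<Sum>i=1..d. (int i)\<^sup>2 - int i * int (\<sigma> i))"
    using sq by (simp add: sum.distrib sum_subtractf sum_distrib_left)
  also have "(\<Sum>i=1..d. (int i)\<^sup>2 - int i * int (\<sigma> i)) =
      (\<Sum>i=1..d. int i * perm_point d \<pi> \<sigma> i) - (\<Sum>i=1..d. int i * perm_point d \<pi> id i)"
    unfolding sum_subtractf[symmetric]
    by (intro sum.cong) (auto simp: perm_point_def algebra_simps power2_eq_square)
  finally show ?thesis by simp
qed

lemma finite_perms_inv: "finite (perms_inv d n)"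
  unfolding perms_inv_def
  by (rule finite_subset[OF _ finite_permutations[of "{1..d}"]]) auto

text \<open>The leading coordinate of each vector is its inversion word. When that of \<pi> occurs
  in the vector of another \<rho>, it comes from some \<open>\<sigma> \<noteq> id\<close>, because
  inversion words determine permutations; hence its weight exceeds that of the leading coordinate of
  \<rho>.\<close>

lemma partial_permutohedron_vecs_independent:
  shows "inj_on (partial_permutohedron_vec d) (perms_inv d n)"
    and "independent (partial_permutohedron_vec d ` perms_inv d n)"
proof -
  let ?m = "\<lambda>\<pi>. perm_point d \<pi> id"
  let ?\<phi> = "\<lambda>\<pi>. \<Sum>i=1..d. int i * ?m \<pi> i"
  have diag: "Poly_Mapping.lookup (partial_permutohedron_vec d \<pi>) (?m \<pi>) \<noteq> 0" for \<pi>
    using lookup_partial_permutohedron_vec_perm_point[OF id_admissible[of d \<pi>]] by simp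
  have tri: "?\<phi> \<rho> < ?\<phi> \<pi>"
    if \<pi>: "\<pi> \<in> perms_inv d n" and \<rho>: "\<rho> \<in> perms_inv d n" and "\<pi> \<noteq> \<rho>"
      and nz: "Poly_Mapping.lookup (partial_permutohedron_vec d \<rho>) (?m \<pi>) \<noteq> 0" for \<pi> \<rho>
  proof -
    have "{\<sigma>. \<sigma> \<in> admissible d \<rho> \<and> perm_point d \<rho> \<sigma> = ?m \<pi>} \<noteq> {}"
      using nz unfolding lookup_partial_permutohedron_vec by (metis sum.empty of_int_0)
    then obtain \<sigma> where \<sigma>: "\<sigma> permutes {1..d}" "perm_point d \<rho> \<sigma> = ?m \<pi>"
      by (auto simp: admissible_def)
    have "\<sigma> \<noteq> id"
    proof
      assume "\<sigma> = id"
      have "inversion_word d \<rho> i = inversion_word d \<pi> i" for i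
        using fun_cong[OF \<sigma>(2), of i] \<open>\<sigma> = id\<close> by (simp add: perm_point_def)
      then have "inversion_word d \<rho> = inversion_word d \<pi>" ..
      moreover have "\<rho> permutes {1..d}" "\<pi> permutes {1..d}"
        using \<pi> \<rho> by (simp_all add: perms_inv_def)
      ultimately have "\<rho> = \<pi>"
        using inversion_word_inj by blast
      then show False using \<open>\<pi> \<noteq> \<rho>\<close> by simp
    qed
    then show ?thesis
      using weighted_sum_perm_point_less[OF \<sigma>(1), of \<rho>] \<sigma>(2) by simp
  qed
  show "inj_on (partial_permutohedron_vec d) (perms_inv d n)"
    by (rule triangular_family_independent(1)[of _ _ ?m ?\<phi>, OF finite_perms_inv diag tri])
  show "independent (partial_permutohedron_vec d ` perms_inv d n)"
    by (rule triangular_family_independent(2)[of _ _ ?m ?\<phi>, OF finite_perms_inv diag tri])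
qed

lemma mahonian_le_dim_SR_eigenspace: "mahonian d n \<le> dim (SR_eigenspace d n (- real n))"
proof -
  let ?B = "partial_permutohedron_vec d ` perms_inv d n"
  have "?B \<subseteq> SR_eigenspace d n (- real n)"
    using partial_permutohedron_vec_in_SR_space SR_A_partial_permutohedron_vec
    by (auto simp: SR_eigenspace_def)
  moreover have "SR_eigenspace d n (- real n) \<subseteq> span (basis_vec ` SR_verts d n)"
    using SR_space_subset_span by (auto simp: SR_eigenspace_def)
  ultimately have "card ?B \<le> dim (SR_eigenspace d n (- real n))"
    by (intro card_le_dim_of_finite_span[OF _ _ partial_permutohedron_vecs_independent(2)])
      (simp_all add: finite_SR_verts)
  then show ?thesis
    by (simp add: mahonian_def card_image[OF partial_permutohedron_vecs_independent(1)])
qed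

theorem theorem3p8:
  fixes d n :: nat
  assumes "d \<ge> 1"
  shows "(\<forall>\<pi>\<in>perms_inv d n. SR_eigenvector d n (- real n) (partial_permutohedron_vec d \<pi>)) \<and>
    (n < d choose 2 \<longrightarrow>
       inj_on (partial_permutohedron_vec d) (perms_inv d n) \<and>
       independent (partial_permutohedron_vec d ` perms_inv d n) \<and>
       dim (SR_eigenspace d n (- real n)) \<ge> mahonian d n)"
  using partial_permutohedron_vec_in_SR_space partial_permutohedron_vec_nonzero
    SR_A_partial_permutohedron_vec partial_permutohedron_vecs_independent
    mahonian_le_dim_SR_eigenspace
  by (simp add: SR_eigenvector_def)

end
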